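(* Let $e'_r$ be the order-$r$ SOS relaxation error of the problem $\min_{x\in\mathbb{R}} x$ s.t. $x^3(1-x)\ge 0$, and let $e''_r$ be the order-$r$ SOS relaxation error of the problem $\min_{x\in\mathbb{R}} x$ s.t. $x^3\ge 0,\ 1-x\ge 0$. Then for every integer $r\ge 3$, $$\frac{1}{4r(r+1)}=e'_{r+1}\le e''_r\le e'_{r-1}=\frac{1}{4(r-1)(r-2)}.$$ In particular, $$\lim_{r\to\infty} r^2 e''_r=\lim_{r\to\infty} r^2 e'_r=\frac14 .$$
   Context: $\Sigma[x]$ denotes the cone of sums of squares of univariate real polynomials. For polynomials $p_1,\ldots,p_k\in\mathbb{R}[x]$ and $p_0:=1$, the truncated quadratic module is $$\mathcal{Q}_r(p_1,\ldots,p_k):=\Big\{\sum_{i=0}^{k}\sigma_i p_i :\ \sigma_i\in\Sigma[x],\ \deg(\sigma_i p_i)\le 2r\Big\},$$ with the zero polynomial regarded as satisfying every degree bound. Both problems have feasible set $[0,1]$ and minimum value $0$. For $r\ge 2$ the relaxation errors are $$e'_r:=0-\sup\{v\in\mathbb{R}: x-v\in\mathcal{Q}_r(x^3(1-x))\},\qquad e''_r:=0-\sup\{v\in\mathbb{R}: x-v\in\mathcal{Q}_r(x^3,1-x)\}.$$ *)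

theory Defs
  imports "HOL-Analysis.Analysis" "HOL-Computational_Algebra.Polynomial"
begin

definition sos :: "real poly set" where
  "sos = {s. \<exists>qs :: real poly list. s = (\<Sum>q\<leftarrow>qs. q\<^sup>2)}"

text \<open>The list \<open>1 # ps\<close> realises the convention \<open>p\<^sub>0 = 1\<close>. Since \<open>degree 0 = 0\<close>, a
  vanishing product satisfies every degree bound.\<close>

definition trunc_qmodule :: "nat \<Rightarrow> real poly list \<Rightarrow> real poly set" where
  "trunc_qmodule r ps =
    {\<Sum>i\<le>length ps. \<sigma> i * (1 # ps) ! i | \<sigma> :: nat \<Rightarrow> real poly.
       \<forall>i\<le>length ps. \<sigma> i \<in> sos \<and> degree (\<sigma> i * (1 # ps) ! i) \<le> 2 * r}"

definition feasible :: "real poly list \<Rightarrow> real set" where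
  "feasible ps = {x. \<forall>p\<in>set ps. poly p x \<ge> 0}"

definition opt_value :: "real poly \<Rightarrow> real poly list \<Rightarrow> ereal" where
  "opt_value f ps = (INF x\<in>feasible ps. ereal (poly f x))"

text \<open>The supremum is taken in the extended reals, so that it is meaningful also when no \<open>v\<close>
  is admissible (value \<open>-\<infinity>\<close>) or when the admissible \<open>v\<close> are unbounded.\<close>

definition sos_bound :: "real poly \<Rightarrow> real poly list \<Rightarrow> nat \<Rightarrow> ereal" where
  "sos_bound f ps r = (SUP v\<in>{v :: real. f - [:v:] \<in> trunc_qmodule r ps}. ereal v)"

definition sos_error :: "real poly \<Rightarrow> real poly list \<Rightarrow> nat \<Rightarrow> ereal" where
  "sos_error f ps r = opt_value f ps - sos_bound f ps r"

abbreviation X :: "real poly" where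
  "X \<equiv> [:0, 1:]"

definition e1 :: "nat \<Rightarrow> ereal" where
  "e1 r = sos_error X [X ^ 3 * (1 - X)] r"

definition e2 :: "nat \<Rightarrow> ereal" where
  "e2 r = sos_error X [X ^ 3, 1 - X] r"

lemma feasible_e1: "feasible [X ^ 3 * (1 - X)] = {0..1}"
proof -
  have cube: "x ^ 3 < 0 \<longleftrightarrow> x < 0" for x :: real
    by (simp add: power_less_zero_eq)
  have "x ^ 3 * (1 - x) \<ge> 0 \<longleftrightarrow> 0 \<le> x \<and> x \<le> 1" for x :: real
  proof (cases "x < 0")
    case True
    then have "x ^ 3 * (1 - x) < 0"
      using cube[of x] by (intro mult_neg_pos) linarith+
    with True show ?thesis by linarith
  next
    case False
    then show ?thesis
      by (cases "x = 0") (simp_all add: zero_le_mult_iff)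
  qed
  then show ?thesis
    unfolding feasible_def by (simp add: atLeastAtMost_def atLeast_def atMost_def Collect_conj_eq)
qed

lemma feasible_e2: "feasible [X ^ 3, 1 - X] = {0..1}"
  unfolding feasible_def by (simp add: zero_le_power_eq set_eq_iff)

lemma opt_value_unit_interval:
  assumes "feasible ps = {0..1}"
  shows "opt_value X ps = 0"
proof (rule antisym)
  show "opt_value X ps \<le> 0"
    unfolding opt_value_def assms by (rule INF_lower2[of 0]) simp_all
  show "0 \<le> opt_value X ps"
    unfolding opt_value_def assms by (rule INF_greatest) simp
qed

lemma e1_eq: "e1 r = 0 - (SUP v\<in>{v. X - [:v:] \<in> trunc_qmodule r [X ^ 3 * (1 - X)]}. ereal v)"
  by (simp add: e1_def sos_error_def sos_bound_def opt_value_unit_interval[OF feasible_e1])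

lemma e2_eq: "e2 r = 0 - (SUP v\<in>{v. X - [:v:] \<in> trunc_qmodule r [X ^ 3, 1 - X]}. ereal v)"
  by (simp add: e2_def sos_error_def sos_bound_def opt_value_unit_interval[OF feasible_e2])

end

theory Submission
  imports Defs "HOL-Real_Asymp.Real_Asymp"
begin

text \<open>Write \<open>x = (1 - cos t) / 2\<close>, so that \<open>x (1 - x) = (sin t)\<^sup>2 / 4\<close>, and let the order be
  \<open>m + 1\<close> with \<open>m \<ge> 1\<close>. For real \<open>\<alpha>\<close>, \<open>\<beta>\<close> the number \<open>w = exp (\<i> m t) (\<alpha> + \<beta> exp (\<i> t))\<close> has squared modulus
  \<open>\<alpha>\<^sup>2 + \<beta>\<^sup>2 + 2 \<alpha> \<beta> cos t\<close>, which is affine in \<open>x\<close>. Its real part is a polynomial \<open>q\<close> in \<open>x\<close> of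
  degree \<open>m + 1\<close>, and its imaginary part is \<open>sin t\<close> times a polynomial in \<open>x\<close> of degree \<open>m\<close>.
  The ratio \<open>\<alpha> : \<beta> = (m + 1) : - m\<close> is the one for which the latter polynomial vanishes at
  \<open>x = 0\<close>. With \<open>\<alpha> = m + 1\<close> and \<open>\<beta> = - m\<close>, splitting off that zero turns
  \<open>(Re w)\<^sup>2 + (Im w)\<^sup>2 = \<bar>w\<bar>\<^sup>2\<close> into
  \<open>q\<^sup>2 + x\<^sup>3 (1 - x) s\<^sup>2 = 1 + 4 m (m + 1) x\<close> with \<open>degree s \<le> m - 1\<close> (lemma \<open>opt_norm\<close>).
  Divided by \<open>4 m (m + 1)\<close> this is a certificate of order \<open>m + 1\<close> for
  \<open>x + \<epsilon>\<close>, where \<open>\<epsilon> = 1 / (4 m (m + 1))\<close>.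

  That \<open>\<epsilon>\<close> is the least possible error is shown by duality. A functional that is nonnegative on
  the quadratic module and vanishes on \<open>x + \<epsilon>\<close> has to vanish on \<open>q\<^sup>2\<close>, which suggests
  a positive combination of evaluations at the zeros of \<open>q\<close>; the right one is
  \<open>L f = (\<Sum>y. f y / y\<^sup>2)\<close> (lemma \<open>exists_dual_functional\<close>). All \<open>m + 1\<close> zeros are real, \<open>m\<close> of
  them lie in \<open>(0, 1)\<close> and one is negative, so \<open>L\<close> is positive on squares but
  \<open>L (x\<^sup>3 (1 - x) b\<^sup>2) = (\<Sum>y. y (1 - y) (b y)\<^sup>2)\<close> has one negative weight. At the zeros,
  \<open>y (1 - y) s(y) q'(y)\<close> is a nonzero constant (lemma \<open>opt_wronskian\<close>), so Euler's identity
  \<open>(\<Sum>y. h y / q' y) = 0\<close> makes \<open>s\<close> orthogonal to every polynomial of degree at most \<open>m - 1\<close>,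
  including itself, for the form with weights \<open>y (1 - y)\<close>. A nondegenerate form with one
  negative square is nonnegative on the orthogonal complement of a nonzero isotropic vector
  (lemma \<open>reverse_Cauchy_Schwarz\<close>). The self-orthogonality of \<open>s\<close> is also what gives
  \<open>L (x + \<epsilon>) = 0\<close>.

  For the description of the interval by \<open>x\<^sup>3\<close> and \<open>1 - x\<close>, the two families of truncated
  modules are interleaved with a shift of the order by one, because of
  \<open>x\<^sup>3 (1 - x) = (1 - x)\<^sup>2 x\<^sup>3 + x\<^sup>4 (1 - x)\<close>, \<open>x\<^sup>3 = x\<^sup>4 + x\<^sup>3 (1 - x)\<close> and
  \<open>1 - x = (1 - x)\<^sup>2 (1 + x + x\<^sup>2) + x\<^sup>3 (1 - x)\<close>.\<close>

section \<open>Shifted Chebyshev polynomials\<close>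

text \<open>\<open>cheb_cos n\<close> and \<open>cheb_sin n\<close> are the Chebyshev polynomials \<open>T\<^sub>n\<close> and \<open>U\<^sub>n\<^sub>-\<^sub>1\<close> at \<open>1 - 2 x\<close>. The
  recursion is the multiplication of \<open>cos (n t) + \<i> sin (n t)\<close> by \<open>cos t + \<i> sin t\<close>, where
  \<open>cos t = 1 - 2 x\<close> and \<open>(sin t)\<^sup>2 = 4 x - 4 x\<^sup>2\<close>.\<close>

fun cheb_cos :: "nat \<Rightarrow> real poly" and cheb_sin :: "nat \<Rightarrow> real poly" where
  "cheb_cos 0 = 1"
| "cheb_cos (Suc n) = [:1, - 2:] * cheb_cos n - [:0, 4, - 4:] * cheb_sin n"
| "cheb_sin 0 = 0"
| "cheb_sin (Suc n) = cheb_cos n + [:1, - 2:] * cheb_sin n"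

lemma cheb_cos_sin_param:
  "poly (cheb_cos n) ((1 - cos t) / 2) = cos (real n * t)"
  "sin t * poly (cheb_sin n) ((1 - cos t) / 2) = sin (real n * t)"
proof (induction n)
  case (Suc n)
  define x where "x = (1 - cos t) / 2"
  have x: "1 - 2 * x = cos t" "4 * x * (1 - x) = sin t * sin t"
    using sin_cos_squared_add[of t] unfolding x_def
    by (simp_all add: power2_eq_square) algebra
  have "poly (cheb_cos (Suc n)) x =
      (1 - 2 * x) * poly (cheb_cos n) x - 4 * x * (1 - x) * poly (cheb_sin n) x"
    by (simp add: algebra_simps)
  also have "\<dots> = cos t * cos (real n * t) - sin t * sin (real n * t)"
    unfolding x using Suc by (simp add: x_def mult.assoc)
  finally show "poly (cheb_cos (Suc n)) ((1 - cos t) / 2) = cos (real (Suc n) * t)"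
    by (simp add: x_def algebra_simps cos_add del: cheb_cos.simps)
  have "sin t * poly (cheb_sin (Suc n)) x =
      sin t * poly (cheb_cos n) x + (1 - 2 * x) * (sin t * poly (cheb_sin n) x)"
    by (simp add: algebra_simps)
  also have "\<dots> = sin t * cos (real n * t) + cos t * sin (real n * t)"
    unfolding x using Suc by (simp add: x_def)
  finally show "sin t * poly (cheb_sin (Suc n)) ((1 - cos t) / 2) = sin (real (Suc n) * t)"
    by (simp add: x_def algebra_simps sin_add del: cheb_sin.simps)
qed auto

lemma cheb_pythagoras:
  "(poly (cheb_cos n) x)\<^sup>2 + 4 * x * (1 - x) * (poly (cheb_sin n) x)\<^sup>2 = 1"
proof (induction n)
  case (Suc n)
  have "(poly (cheb_cos (Suc n)) x)\<^sup>2 + 4 * x * (1 - x) * (poly (cheb_sin (Suc n)) x)\<^sup>2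
     = (poly (cheb_cos n) x)\<^sup>2 + 4 * x * (1 - x) * (poly (cheb_sin n) x)\<^sup>2"
    by simp algebra
  with Suc show ?case by simp
qed auto

text \<open>The chain rule for \<open>cos (n t)\<close> and \<open>sin (n t) / sin t\<close>, proved algebraically; the second
  formula is what carries the induction for the first.\<close>

lemma pderiv_cheb:
  "poly (pderiv (cheb_cos n)) x = - 2 * real n * poly (cheb_sin n) x"
  "4 * x * (1 - x) * poly (pderiv (cheb_sin n)) x =
     2 * real n * poly (cheb_cos n) x - 2 * (1 - 2 * x) * poly (cheb_sin n) x"
proof (induction n)
  case (Suc n)
  let ?P = "poly (cheb_cos n) x" and ?Q = "poly (cheb_sin n) x"
    and ?Q' = "poly (pderiv (cheb_sin n)) x"
  have "poly (pderiv (cheb_cos (Suc n))) x =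
      - 2 * ?P + (1 - 2 * x) * (- 2 * real n * ?Q) - (4 - 8 * x) * ?Q - 4 * x * (1 - x) * ?Q'"
    by (simp add: pderiv_mult pderiv_diff pderiv_pCons Suc(1) del: mult_pCons_left)
      (simp add: algebra_simps)
  then show "poly (pderiv (cheb_cos (Suc n))) x = - 2 * real (Suc n) * poly (cheb_sin (Suc n)) x"
    by (simp only: Suc(2)) (simp add: algebra_simps)
  have "4 * x * (1 - x) * poly (pderiv (cheb_sin (Suc n))) x =
      4 * x * (1 - x) * (- 2 * real n * ?Q - 2 * ?Q) + (1 - 2 * x) * (4 * x * (1 - x) * ?Q')"
    by (simp add: pderiv_mult pderiv_add pderiv_pCons Suc(1) del: mult_pCons_left)
      (simp add: algebra_simps)
  then show "4 * x * (1 - x) * poly (pderiv (cheb_sin (Suc n))) x =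
     2 * real (Suc n) * poly (cheb_cos (Suc n)) x - 2 * (1 - 2 * x) * poly (cheb_sin (Suc n)) x"
    by (simp only: Suc(2)) (simp add: algebra_simps)
qed auto

lemma degree_cheb:
  "degree (cheb_cos n) \<le> n \<and> (n = 0 \<or> degree (cheb_sin n) < n)"
proof (induction n)
  case (Suc n)
  have lin: "degree ([:1, - 2:] * p) \<le> Suc (degree p)" for p :: "real poly"
    using degree_mult_le[of "[:1, - 2:]" p] by simp
  have quad: "degree ([:0, 4, - 4:] * cheb_sin n) \<le> Suc n"
    using degree_mult_le[of "[:0, 4, - 4:]" "cheb_sin n"] Suc by (cases n) auto
  have "degree ([:1, - 2:] * cheb_sin n) \<le> n"
    using lin[of "cheb_sin n"] Suc by (cases n) auto
  with Suc lin[of "cheb_cos n"] quad show ?case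
    by (auto intro!: degree_diff_le degree_add_le simp: less_Suc_eq_le
        simp del: mult_pCons_left)
qed auto

lemma cheb_at_0: "poly (cheb_cos n) 0 = 1" "poly (cheb_sin n) 0 = real n"
  by (induction n) auto

lemma cheb_at_minus_1: "poly (cheb_cos n) (- 1) > 0" "poly (cheb_sin n) (- 1) \<ge> 0"
  by (induction n) auto

section \<open>The optimal certificate\<close>

text \<open>\<open>opt_cos m\<close> and \<open>X * opt_sin m / 2\<close> are the real part, and the imaginary part divided by
  \<open>sin t\<close>, of \<open>exp (\<i> m t) (m + 1 - m exp (\<i> t))\<close>. The division by \<open>X\<close> is exact.\<close>

definition opt_cos :: "nat \<Rightarrow> real poly" where
  "opt_cos m = smult (real m + 1) (cheb_cos m) - smult (real m) (cheb_cos (Suc m))"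

definition opt_sin :: "nat \<Rightarrow> real poly" where
  "opt_sin m = smult 2 (smult (real m + 1) (cheb_sin m) - smult (real m) (cheb_sin (Suc m))) div X"

lemma X_opt_sin:
  "X * opt_sin m = smult 2 (smult (real m + 1) (cheb_sin m) - smult (real m) (cheb_sin (Suc m)))"
    (is "_ = ?B")
proof -
  have "poly ?B 0 = 0"
    by (simp add: cheb_at_0 algebra_simps del: cheb_sin.simps)
  then have "X dvd ?B"
    using poly_eq_0_iff_dvd[of ?B 0] by simp
  then show ?thesis
    unfolding opt_sin_def by (rule dvd_mult_div_cancel)
qed

lemma poly_opt_cos:
  "poly (opt_cos m) x =
    (1 + 2 * m * x) * poly (cheb_cos m) x + 4 * m * x * (1 - x) * poly (cheb_sin m) x"
  unfolding opt_cos_def by (simp add: algebra_simps)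

lemma poly_opt_sin:
  "x * poly (opt_sin m) x =
    2 * ((1 + 2 * m * x) * poly (cheb_sin m) x - m * poly (cheb_cos m) x)"
  using arg_cong[OF X_opt_sin, of "\<lambda>p. poly p x"] by (simp add: algebra_simps)

lemma poly_pderiv_opt_cos:
  "poly (pderiv (opt_cos m)) x =
    2 * real m * (real m + 1) * (poly (cheb_cos m) x - 2 * x * poly (cheb_sin m) x)"
  unfolding opt_cos_def
  by (simp add: pderiv_diff pderiv_smult pderiv_cheb del: cheb_cos.simps)
    (simp add: algebra_simps)

text \<open>The squared modulus of \<open>exp (\<i> m t) (m + 1 - m exp (\<i> t))\<close> is
  \<open>(m + 1)\<^sup>2 + m\<^sup>2 - 2 m (m + 1) cos t\<close>.\<close>

lemma opt_norm:
  "(poly (opt_cos m) x)\<^sup>2 + x ^ 3 * (1 - x) * (poly (opt_sin m) x)\<^sup>2 = 1 + 4 * real m * (real m + 1) * x"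
proof -
  define P Q where "P = poly (cheb_cos m) x" and "Q = poly (cheb_sin m) x"
  have "(poly (opt_cos m) x)\<^sup>2 + x ^ 3 * (1 - x) * (poly (opt_sin m) x)\<^sup>2 =
     (poly (opt_cos m) x)\<^sup>2 + x * (1 - x) * (x * poly (opt_sin m) x)\<^sup>2"
    by (simp add: power2_eq_square power3_eq_cube)
  also have "\<dots> = (1 + 4 * real m * (real m + 1) * x) * (P\<^sup>2 + 4 * x * (1 - x) * Q\<^sup>2)"
    unfolding poly_opt_sin poly_opt_cos P_def[symmetric] Q_def[symmetric]
    by algebra
  finally show ?thesis
    by (simp add: P_def Q_def cheb_pythagoras)
qed

text \<open>Let \<open>w = exp (\<i> m t) (m + 1 - m exp (\<i> t))\<close>. At a zero of \<open>Re w\<close>, the derivative of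
  \<open>Re w\<close> in \<open>t\<close> is \<open>- Im w\<close> times the derivative of \<open>arg w\<close>, which is
  \<open>m (m + 1) (2 m + 1) (1 - cos t) / \<bar>w\<bar>\<^sup>2\<close>. As \<open>\<bar>w\<bar>\<^sup>2 = (Im w)\<^sup>2\<close> there, the product of
  \<open>Im w\<close> with the derivative of \<open>Re w\<close> is a constant multiple of \<open>1 - cos t\<close>. Written in \<open>x\<close>
  this becomes an algebraic identity, which also covers the zeros outside \<open>[0, 1]\<close>.\<close>

lemma opt_wronskian:
  assumes "poly (opt_cos m) y = 0"
  shows "y * (1 - y) * poly (opt_sin m) y * poly (pderiv (opt_cos m)) y =
    - 2 * real m * (real m + 1) * (2 * real m + 1)"
proof -
  define P Q where "P = poly (cheb_cos m) y" and "Q = poly (cheb_sin m) y"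
  have norm: "P\<^sup>2 + 4 * y * (1 - y) * Q\<^sup>2 = 1"
    by (simp add: P_def Q_def cheb_pythagoras)
  have root: "(1 + 2 * real m * y) * P + 4 * real m * y * (1 - y) * Q = 0"
    using assms by (simp add: poly_opt_cos P_def Q_def)
  have "y * (1 - y) * poly (opt_sin m) y * poly (pderiv (opt_cos m)) y =
     (1 - y) * (y * poly (opt_sin m) y) * poly (pderiv (opt_cos m)) y"
    by (simp only: ac_simps)
  also have "\<dots> = (1 - y) * (2 * ((1 + 2 * real m * y) * Q - real m * P)) *
     (2 * real m * (real m + 1) * (P - 2 * y * Q))"
    unfolding poly_pderiv_opt_cos poly_opt_sin P_def Q_def by simp
  \<comment> \<open>Modulo \<open>opt_cos m\<close> the product is a multiple of the Pythagorean form in \<open>P\<close> and \<open>Q\<close>;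
    the cofactor \<open>P + 2 (1 - y) Q\<close> comes from comparing coefficients.\<close>
  also have "\<dots> = - 2 * real m * (real m + 1) *
     ((2 * real m + 1) * (P\<^sup>2 + 4 * y * (1 - y) * Q\<^sup>2) -
      ((1 + 2 * real m * y) * P + 4 * real m * y * (1 - y) * Q) * (P + 2 * (1 - y) * Q))"
    by algebra
  finally show ?thesis
    unfolding norm root by simp
qed

lemma degree_opt_cos: "degree (opt_cos m) \<le> Suc m"
  unfolding opt_cos_def
  using degree_cheb[of m] degree_cheb[of "Suc m"]
  by (auto intro!: degree_diff_le order.trans[OF degree_smult_le] simp del: cheb_cos.simps)

lemma degree_opt_sin:
  assumes "m \<ge> 1"
  shows "degree (opt_sin m) \<le> m - 1"
proof (cases "opt_sin m = 0")
  case False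
  have "degree (X * opt_sin m) \<le> m"
    unfolding X_opt_sin using degree_cheb[of m] degree_cheb[of "Suc m"] assms
    by (auto intro!: degree_diff_le order.trans[OF degree_smult_le] simp del: cheb_sin.simps)
  with False show ?thesis
    by (subst (asm) degree_mult_eq) auto
qed auto

section \<open>The zeros of the real part\<close>

lemma roots_of_alternating_signs:
  fixes p :: "real poly"
  assumes mono: "\<And>i. i < n \<Longrightarrow> a i < a (Suc i)"
    and sign: "\<And>i. i \<le> n \<Longrightarrow> (- 1) ^ i * poly p (a i) < 0"
  obtains y where "\<And>i. i < n \<Longrightarrow> a i < y i \<and> y i < a (Suc i) \<and> poly p (y i) = 0"
proof -
  have "\<exists>y. a i < y \<and> y < a (Suc i) \<and> poly p y = 0" if "i < n" for i
  proof -
    have "poly p (a i) * poly p (a (Suc i)) < 0"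
      using sign[of i] sign[of "Suc i"] that
      by (cases "even i") (auto simp: mult_pos_neg mult_neg_pos)
    from poly_IVT[OF mono[OF that] this] show ?thesis by auto
  qed
  then have "\<exists>y. \<forall>i<n. a i < y i \<and> y i < a (Suc i) \<and> poly p (y i) = 0"
    by metis
  with that show thesis by blast
qed

text \<open>At \<open>t = k pi / m\<close>, an extremal point of \<open>cos (m t) = (-1)\<^sup>k\<close>, also
  \<open>cos ((m + 1) t) = (-1)\<^sup>k cos t\<close>. So \<open>opt_cos m\<close> takes the value \<open>(-1)\<^sup>k (m + 1 - m cos t)\<close>,
  whose second factor is at least \<open>1\<close>.\<close>

lemma poly_opt_cos_extrema:
  assumes "m \<ge> 1"
  shows "(- 1) ^ k * poly (opt_cos m) ((1 - cos (k * pi / m)) / 2) > 0"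
proof -
  define t where "t = k * pi / m"
  have mt: "real m * t = k * pi"
    using assms by (simp add: t_def)
  have "poly (opt_cos m) ((1 - cos t) / 2) = (real m + 1) * cos (real m * t) - real m * cos (real (Suc m) * t)"
    unfolding opt_cos_def poly_diff poly_smult cheb_cos_sin_param ..
  also have "\<dots> = (- 1) ^ k * (m + 1 - m * cos t)"
    using mt by (simp add: algebra_simps cos_add)
  finally have eq: "poly (opt_cos m) ((1 - cos t) / 2) = (- 1) ^ k * (m + 1 - m * cos t)" .
  have "m * cos t \<le> m"
    using cos_le_one[of t] by (simp add: mult_left_le)
  moreover have "(- 1) ^ k * poly (opt_cos m) ((1 - cos t) / 2) = m + 1 - m * cos t"
    unfolding eq by (cases "even k") simp_all
  ultimately show ?thesis
    unfolding t_def by simp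
qed

lemma opt_cos_at_minus_1:
  assumes "m \<ge> 1"
  shows "poly (opt_cos m) (- 1) < 0"
proof -
  have "(1 - 2 * real m) * poly (cheb_cos m) (- 1) < 0"
    using assms cheb_at_minus_1[of m] by (intro mult_neg_pos) auto
  moreover have "real m * poly (cheb_sin m) (- 1) \<ge> 0"
    using cheb_at_minus_1[of m] by simp
  ultimately show ?thesis
    unfolding poly_opt_cos by simp
qed

text \<open>The \<open>m + 1\<close> extremal points give \<open>m\<close> sign changes in \<open>[0, 1]\<close>, and the point \<open>- 1\<close> adds
  one more to the left of \<open>0\<close>.\<close>

lemma opt_cos_nodes:
  assumes "m \<ge> 1"
  obtains Y y\<^sub>0 where
    "finite Y" "card Y = m" "y\<^sub>0 < 0" "Y \<subseteq> {0<..<1}"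
    "\<And>y. y \<in> insert y\<^sub>0 Y \<Longrightarrow> poly (opt_cos m) y = 0"
proof -
  define a :: "nat \<Rightarrow> real" where
    "a i = (case i of 0 \<Rightarrow> - 1 | Suc k \<Rightarrow> (1 - cos (k * pi / m)) / 2)" for i
  have a_less: "a i < a (Suc i)" if "i < Suc m" for i
  proof (cases i)
    case (Suc k)
    have "cos (real (Suc k) * pi / m) < cos (k * pi / m)"
      using that Suc assms by (intro cos_monotone_0_pi) (auto simp: field_simps simp flip: distrib_left of_nat_Suc)
    then show ?thesis by (simp add: a_def Suc)
  qed (simp add: a_def)
  have sign: "(- 1) ^ i * poly (opt_cos m) (a i) < 0" for i
    using poly_opt_cos_extrema[OF assms] opt_cos_at_minus_1[OF assms]
    by (cases i) (simp_all add: a_def)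
  obtain y where y: "\<And>i. i < Suc m \<Longrightarrow>
      a i < y i \<and> y i < a (Suc i) \<and> poly (opt_cos m) (y i) = 0"
    using roots_of_alternating_signs[of "Suc m" a "opt_cos m", OF a_less sign] by blast
  have y_mono: "y i < y (Suc i)" if "Suc i < Suc m" for i
    using y[of i] y[of "Suc i"] that by simp
  have y_less: "y i < y j" if "i < j" "j < Suc m" for i j
    using that
  proof (induction j)
    case (Suc j)
    then show ?case
      using y_mono[of j] by (cases "i = j") auto
  qed simp
  have inj: "inj_on y {1..m}"
    using y_less by (intro linorder_inj_onI) fastforce+
  have in01: "y i \<in> {0<..<1}" if "i \<in> {1..m}" for i
  proof -
    obtain k where k: "i = Suc k" using \<open>i \<in> {1..m}\<close> by (cases i) auto
    have "a i \<ge> 0" "a (Suc i) \<le> 1"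
      using cos_le_one[of "k * pi / m"] cos_ge_minus_one[of "(1 + k) * pi / m"] by (auto simp: a_def k)
    then show ?thesis
      using y[of i] that by auto
  qed
  have "y 0 < 0"
    using y[of 0] by (simp add: a_def)
  with inj in01 y show thesis
    by (intro that[of "y ` {1..m}" "y 0"]) (auto simp: card_image)
qed

section \<open>Euler's identity\<close>

text \<open>By Lagrange interpolation, \<open>h\<close> is the sum of the polynomials
  \<open>(h y / p' y) (p / (x - y))\<close>. They have degree \<open>card Y - 1\<close> and leading coefficient
  \<open>(h y / p' y) lead_coeff p\<close>, and \<open>h\<close> has no term of that degree.\<close>

lemma sum_over_roots_pderiv:
  fixes p h :: "'a :: field poly"
  assumes card: "degree p = card Y"
    and root: "\<And>y. y \<in> Y \<Longrightarrow> poly p y = 0"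
    and simple: "\<And>y. y \<in> Y \<Longrightarrow> poly (pderiv p) y \<noteq> 0"
    and deg: "degree h + 2 \<le> card Y"
  shows "(\<Sum>y\<in>Y. poly h y / poly (pderiv p) y) = 0"
proof -
  have fin: "finite Y"
    using deg card_ge_0_finite[of Y] by linarith
  define g where "g y = p div [:- y, 1:]" for y
  have p_eq: "p = [:- y, 1:] * g y" if "y \<in> Y" for y
    using root[OF that] unfolding g_def poly_eq_0_iff_dvd by (simp only: dvd_mult_div_cancel)
  have p0: "p \<noteq> 0"
    using card deg by auto
  have g_lead: "degree (g y) = card Y - 1" "coeff (g y) (card Y - 1) = lead_coeff p"
    if "y \<in> Y" for y
  proof -
    have "g y \<noteq> 0" using p_eq[OF that] p0 by (metis mult_zero_right)
    then have "degree p = Suc (degree (g y))"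
      by (subst p_eq[OF that], subst degree_mult_eq) auto
    then show d: "degree (g y) = card Y - 1" using card by simp
    have "lead_coeff p = lead_coeff (g y)"
      by (subst (1 2) p_eq[OF that], subst lead_coeff_mult) simp
    with d show "coeff (g y) (card Y - 1) = lead_coeff p" by simp
  qed
  have g_diag: "poly (g y) y = poly (pderiv p) y" if "y \<in> Y" for y
    by (subst p_eq[OF that], simp only: pderiv_mult) (simp add: pderiv_pCons)
  have g_off: "poly (g y) z = 0" if "y \<in> Y" "z \<in> Y" "z \<noteq> y" for y z
  proof -
    have "(z - y) * poly (g y) z = poly p z"
      by (subst p_eq[OF that(1)]) (simp add: algebra_simps)
    with root[OF that(2)] that(3) show ?thesis by simp
  qed
  define R where "R = (\<Sum>y\<in>Y. smult (poly h y / poly (pderiv p) y) (g y))"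
  have "R = h"
  proof (rule poly_eqI_degree[of Y])
    fix z assume z: "z \<in> Y"
    have "poly R z = (\<Sum>y\<in>Y. if y = z then poly h z else 0)"
      unfolding R_def poly_sum poly_smult
      using g_diag g_off simple z by (intro sum.cong) auto
    then show "poly R z = poly h z" using fin z by simp
  next
    show "card Y > degree h" using deg by simp
    have "degree R \<le> card Y - 1"
      unfolding R_def
      by (intro degree_sum_le fin order.trans[OF degree_smult_le]) (simp add: g_lead)
    then show "card Y > degree R" using deg by simp
  qed
  have "0 = coeff R (card Y - 1)"
    unfolding \<open>R = h\<close> using deg by (intro coeff_eq_0[symmetric]) simp
  also have "\<dots> = (\<Sum>y\<in>Y. poly h y / poly (pderiv p) y * lead_coeff p)"
    unfolding R_def coeff_sum coeff_smult by (intro sum.cong refl) (simp only: g_lead)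
  finally have "(\<Sum>y\<in>Y. poly h y / poly (pderiv p) y) * lead_coeff p = 0"
    by (simp only: sum_distrib_right)
  then show ?thesis using p0 by simp
qed

section \<open>The dual functional\<close>

text \<open>Orthogonality to the isotropic vector \<open>s\<close> expresses the negative term through the others:
  \<open>\<bar>w y\<^sub>0\<bar> s(y\<^sub>0) b(y\<^sub>0)\<close> is the inner product of \<open>s\<close> and \<open>b\<close> over \<open>Y\<close>, and
  \<open>\<bar>w y\<^sub>0\<bar> s(y\<^sub>0)\<^sup>2\<close> is the squared length of \<open>s\<close> there. The Cauchy-Schwarz inequality on \<open>Y\<close> then
  bounds \<open>\<bar>w y\<^sub>0\<bar> b(y\<^sub>0)\<^sup>2\<close>.\<close>

lemma reverse_Cauchy_Schwarz:
  fixes w s b :: "'a \<Rightarrow> real"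
  assumes fin: "finite Y" and y0: "y\<^sub>0 \<notin> Y"
    and neg: "w y\<^sub>0 < 0" and pos: "\<And>y. y \<in> Y \<Longrightarrow> w y \<ge> 0"
    and s0: "s y\<^sub>0 \<noteq> 0"
    and null: "(\<Sum>y\<in>insert y\<^sub>0 Y. w y * (s y)\<^sup>2) = 0"
    and orth: "(\<Sum>y\<in>insert y\<^sub>0 Y. w y * s y * b y) = 0"
  shows "(\<Sum>y\<in>insert y\<^sub>0 Y. w y * (b y)\<^sup>2) \<ge> 0"
proof -
  let ?n = "- w y\<^sub>0"
  have s2: "(\<Sum>y\<in>Y. w y * (s y)\<^sup>2) = ?n * (s y\<^sub>0)\<^sup>2"
    using null fin y0 by simp
  have sb: "(\<Sum>y\<in>Y. w y * s y * b y) = ?n * s y\<^sub>0 * b y\<^sub>0"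
    using orth fin y0 by simp
  have "(\<Sum>y\<in>Y. (sqrt (w y) * s y) * (sqrt (w y) * b y))\<^sup>2 \<le>
      (\<Sum>y\<in>Y. (sqrt (w y) * s y)\<^sup>2) * (\<Sum>y\<in>Y. (sqrt (w y) * b y)\<^sup>2)"
    by (rule Cauchy_Schwarz_ineq_sum)
  also have "(\<Sum>y\<in>Y. (sqrt (w y) * s y) * (sqrt (w y) * b y)) = (\<Sum>y\<in>Y. w y * s y * b y)"
    using pos by (intro sum.cong refl)
      (metis (no_types, lifting) mult.assoc mult.left_commute real_sqrt_mult_self abs_of_nonneg)
  also have "(\<Sum>y\<in>Y. (sqrt (w y) * s y)\<^sup>2) = (\<Sum>y\<in>Y. w y * (s y)\<^sup>2)"
    using pos by (intro sum.cong) (auto simp: power_mult_distrib)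
  also have "(\<Sum>y\<in>Y. (sqrt (w y) * b y)\<^sup>2) = (\<Sum>y\<in>Y. w y * (b y)\<^sup>2)"
    using pos by (intro sum.cong) (auto simp: power_mult_distrib)
  finally have "(?n * (s y\<^sub>0)\<^sup>2) * (?n * (b y\<^sub>0)\<^sup>2) \<le> (?n * (s y\<^sub>0)\<^sup>2) * (\<Sum>y\<in>Y. w y * (b y)\<^sup>2)"
    unfolding s2 sb by (simp add: power2_eq_square algebra_simps)
  moreover have "?n * (s y\<^sub>0)\<^sup>2 > 0"
    using neg s0 by (intro mult_pos_pos) auto
  ultimately have "?n * (b y\<^sub>0)\<^sup>2 \<le> (\<Sum>y\<in>Y. w y * (b y)\<^sup>2)"
    using mult_le_cancel_left_pos by blast
  then show ?thesis using fin y0 by simp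
qed

text \<open>\<open>Y\<close> consists of the zeros of \<open>opt_cos m\<close>. Since \<open>y\<^sup>3 (1 - y) / y\<^sup>2 = y (1 - y)\<close>, and since
  \<open>opt_norm\<close> at a zero reads \<open>(y + \<epsilon>) / y\<^sup>2 = \<epsilon> y (1 - y) s(y)\<^sup>2\<close>, both claims are about the
  quadratic form with weights \<open>y (1 - y)\<close>.\<close>

lemma exists_dual_functional:
  assumes "m \<ge> 1"
  obtains Y where "finite Y" "Y \<noteq> {}" "0 \<notin> Y"
    "(\<Sum>y\<in>Y. (y + 1 / (4 * real m * (real m + 1))) / y\<^sup>2) = 0"
    "\<And>b. degree b \<le> m - 1 \<Longrightarrow> (\<Sum>y\<in>Y. y ^ 3 * (1 - y) * (poly b y)\<^sup>2 / y\<^sup>2) \<ge> 0"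
proof -
  let ?q = "opt_cos m" and ?s = "opt_sin m"
  obtain Y y0 where Y: "finite Y" "card Y = m" "y0 < 0" "Y \<subseteq> {0<..<1}"
    and root: "\<And>y. y \<in> insert y0 Y \<Longrightarrow> poly ?q y = 0"
    using opt_cos_nodes[OF assms] by blast
  let ?Z = "insert y0 Y"
  define w where "w y = y * (1 - y)" for y :: real
  define c where "c = - 2 * real m * (real m + 1) * (2 * real m + 1)"
  have "c \<noteq> 0" using assms by (simp add: c_def add_eq_0_iff2)
  have wr: "w y * poly ?s y * poly (pderiv ?q) y = c" if "y \<in> ?Z" for y
    using opt_wronskian[OF root[OF that]] unfolding w_def c_def by simp
  have y0: "y0 \<notin> Y" using Y by auto
  have cardZ: "card ?Z = Suc m" using Y y0 by simp
  have q0: "?q \<noteq> 0"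
    using opt_cos_at_minus_1[OF assms] by auto
  \<comment> \<open>There are as many zeros as the degree allows, so Euler's identity applies to \<open>?Z\<close>.\<close>
  have "card ?Z \<le> card {x. poly ?q x = 0}"
    using root by (intro card_mono poly_roots_finite q0) auto
  also have "\<dots> \<le> degree ?q"
    by (rule card_poly_roots_bound[OF q0])
  finally have degq: "degree ?q = card ?Z"
    using degree_opt_cos[of m] cardZ by simp
  have orth: "(\<Sum>y\<in>?Z. w y * poly ?s y * poly h y) = 0" if "degree h \<le> m - 1" for h
  proof -
    have "(\<Sum>y\<in>?Z. poly h y / poly (pderiv ?q) y) = 0"
    proof (rule sum_over_roots_pderiv[OF degq])
      show "poly (pderiv ?q) y \<noteq> 0" if "y \<in> ?Z" for y
        using wr[OF that] \<open>c \<noteq> 0\<close> by auto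
    qed (use root that cardZ assms in auto)
    moreover have "w y * poly ?s y * poly h y = c * (poly h y / poly (pderiv ?q) y)" if "y \<in> ?Z" for y
      using wr[OF that] \<open>c \<noteq> 0\<close> by (cases "poly (pderiv ?q) y = 0") (auto simp: field_simps)
    ultimately show ?thesis
      by (simp only: sum_distrib_left[symmetric] mult_zero_right cong: sum.cong)
  qed
  have null: "(\<Sum>y\<in>?Z. w y * (poly ?s y)\<^sup>2) = 0"
    using orth[OF degree_opt_sin[OF assms]] by (simp add: power2_eq_square mult.assoc)
  have nz: "0 \<notin> ?Z" using Y by auto
  have cube: "y ^ 3 * (1 - y) * z / y\<^sup>2 = w y * z" if "y \<in> ?Z" for y z
    using nz that by (cases "y = 0") (auto simp: w_def power2_eq_square power3_eq_cube)
  show thesis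
  proof (rule that[of ?Z])
    have "(y + 1 / (4 * real m * (real m + 1))) / y\<^sup>2 =
        1 / (4 * real m * (real m + 1)) * (w y * (poly ?s y)\<^sup>2)" if "y \<in> ?Z" for y
    proof -
      have "y ^ 3 * (1 - y) * (poly ?s y)\<^sup>2 = 1 + 4 * real m * (real m + 1) * y"
        using opt_norm[of m y] root[OF that] by simp
      then have "w y * (poly ?s y)\<^sup>2 = (1 + 4 * real m * (real m + 1) * y) / y\<^sup>2"
        using cube[OF that] by metis
      moreover have "y + 1 / k = 1 / k * (1 + k * y)" if "k \<noteq> 0" for k
        using that by (simp add: field_simps)
      ultimately show ?thesis using assms by simp
    qed
    then show "(\<Sum>y\<in>?Z. (y + 1 / (4 * real m * (real m + 1))) / y\<^sup>2) = 0"
      using null by (simp only: sum_distrib_left[symmetric] mult_zero_right cong: sum.cong)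
  next
    fix b :: "real poly" assume b: "degree b \<le> m - 1"
    have "poly ?s y0 \<noteq> 0" using wr[of y0] \<open>c \<noteq> 0\<close> by auto
    then have "(\<Sum>y\<in>?Z. w y * (poly b y)\<^sup>2) \<ge> 0"
      using Y y0 null orth[OF b]
      by (intro reverse_Cauchy_Schwarz[where s = "poly ?s"]) (auto simp: w_def mult_neg_pos)
    then show "(\<Sum>y\<in>?Z. y ^ 3 * (1 - y) * (poly b y)\<^sup>2 / y\<^sup>2) \<ge> 0"
      using cube by (simp del: sum.insert)
  qed (use Y nz in auto)
qed

section \<open>Sums of squares\<close>

lemma poly_sum_list_squares: "poly (\<Sum>q\<leftarrow>qs. q\<^sup>2) x = (\<Sum>q\<leftarrow>qs. (poly q x)\<^sup>2)"
  by (induction qs) auto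

lemma sos_square: "q\<^sup>2 \<in> sos"
  unfolding sos_def by (intro CollectI exI[of _ "[q]"]) simp

lemma sos_add: "s \<in> sos \<Longrightarrow> t \<in> sos \<Longrightarrow> s + t \<in> sos"
  unfolding sos_def
proof safe
  fix ps qs :: "real poly list"
  show "\<exists>rs. (\<Sum>q\<leftarrow>ps. q\<^sup>2) + (\<Sum>q\<leftarrow>qs. q\<^sup>2) = (\<Sum>q\<leftarrow>rs. q\<^sup>2)"
    by (rule exI[of _ "ps @ qs"]) simp
qed

lemma sos_mult_square: "s \<in> sos \<Longrightarrow> s * p\<^sup>2 \<in> sos"
  unfolding sos_def
proof safe
  fix qs :: "real poly list"
  show "\<exists>rs. (\<Sum>q\<leftarrow>qs. q\<^sup>2) * p\<^sup>2 = (\<Sum>q\<leftarrow>rs. q\<^sup>2)"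
    by (rule exI[of _ "map (\<lambda>q. q * p) qs"])
      (simp add: sum_list_mult_const[symmetric] o_def power_mult_distrib)
qed

lemma poly_sos_nonneg: "s \<in> sos \<Longrightarrow> poly s x \<ge> 0"
  unfolding sos_def by (auto simp: poly_sum_list_squares intro!: sum_list_nonneg)

lemma coeff_sum_squares:
  fixes qs :: "real poly list"
  assumes "\<forall>q\<in>set qs. degree q \<le> d"
  shows "coeff (\<Sum>q\<leftarrow>qs. q\<^sup>2) (2 * d) = (\<Sum>q\<leftarrow>qs. (coeff q d)\<^sup>2)"
  using assms
proof (induction qs)
  case (Cons q qs)
  have "coeff (q * q) (d + d) = coeff q d * coeff q d"
    using Cons.prems
    by (cases "degree q = d") (auto simp: coeff_mult_degree_sum coeff_eq_0 intro!: coeff_eq_0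
        order.strict_trans1[OF degree_mult_le])
  with Cons show ?case by (simp add: power2_eq_square mult_2)
qed simp

text \<open>The squares of the leading coefficients cannot cancel.\<close>

lemma degree_sum_squares:
  fixes qs :: "real poly list"
  obtains d where "degree (\<Sum>q\<leftarrow>qs. q\<^sup>2) = 2 * d" "\<And>q. q \<in> set qs \<Longrightarrow> degree q \<le> d"
proof (cases "\<forall>q\<in>set qs. q = 0")
  case True
  then have "(\<Sum>q\<leftarrow>qs. q\<^sup>2) = 0" by (induction qs) auto
  with True show thesis by (intro that[of 0]) auto
next
  case False
  define d where "d = Max (degree ` set qs)"
  have bound: "\<forall>q\<in>set qs. degree q \<le> d"
    by (simp add: d_def)
  have "d \<in> degree ` set qs"
    unfolding d_def using False by (intro Max_in) auto
  then obtain p where p: "p \<in> set qs" "degree p = d" by auto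
  have "\<exists>p\<in>set qs. coeff p d \<noteq> 0"
  proof (cases "p = 0")
    case True
    with p bound False show ?thesis by (metis degree_0 le_zero_eq leading_coeff_neq_0)
  qed (use p in \<open>auto intro!: bexI[of _ p]\<close>)
  then have "(\<Sum>q\<leftarrow>qs. (coeff q d)\<^sup>2) \<noteq> 0"
    by (subst sum_list_nonneg_eq_0_iff) auto
  then have "2 * d \<le> degree (\<Sum>q\<leftarrow>qs. q\<^sup>2)"
    unfolding coeff_sum_squares[OF bound, symmetric] by (rule le_degree)
  moreover have "degree (\<Sum>q\<leftarrow>qs. q\<^sup>2) \<le> 2 * d"
    using bound
  proof (induction qs)
    case (Cons q qs)
    then have "degree (q\<^sup>2) \<le> 2 * d"
      using degree_power_le[of q 2] by auto
    with Cons show ?case by (auto intro: degree_add_le)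
  qed simp
  ultimately show thesis using bound by (intro that[of d]) auto
qed

lemma even_degree_sos: "s \<in> sos \<Longrightarrow> even (degree s)"
  unfolding sos_def
proof safe
  fix qs :: "real poly list"
  obtain d where "degree (\<Sum>q\<leftarrow>qs. q\<^sup>2) = 2 * d"
    by (rule degree_sum_squares)
  then show "even (degree (\<Sum>q\<leftarrow>qs. q\<^sup>2))" by simp
qed

section \<open>Truncated quadratic modules\<close>

lemma mem_trunc_qmodule_1:
  "f \<in> trunc_qmodule r [g] \<longleftrightarrow>
    (\<exists>s t. f = s + t * g \<and> s \<in> sos \<and> t \<in> sos \<and> degree s \<le> 2 * r \<and> degree (t * g) \<le> 2 * r)"
    (is "_ \<longleftrightarrow> (\<exists>s t. ?R s t)")
proof -
  have "f \<in> trunc_qmodule r [g] \<longleftrightarrow> (\<exists>\<sigma>. ?R (\<sigma> 0) (\<sigma> (1::nat)))"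
    unfolding trunc_qmodule_def by (auto simp: le_Suc_eq all_conj_distrib)
  also have "\<dots> \<longleftrightarrow> (\<exists>s t. ?R s t)"
  proof
    assume "\<exists>s t. ?R s t"
    then obtain s t where "?R s t" by blast
    then show "\<exists>\<sigma>. ?R (\<sigma> 0) (\<sigma> (1::nat))"
      by (intro exI[of _ "(!) [s, t]"]) simp
  qed blast
  finally show ?thesis .
qed

lemma mem_trunc_qmodule_2:
  "f \<in> trunc_qmodule r [g, h] \<longleftrightarrow>
    (\<exists>s t u. f = s + t * g + u * h \<and> s \<in> sos \<and> t \<in> sos \<and> u \<in> sos \<and>
      degree s \<le> 2 * r \<and> degree (t * g) \<le> 2 * r \<and> degree (u * h) \<le> 2 * r)"
    (is "_ \<longleftrightarrow> (\<exists>s t u. ?R s t u)")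
proof -
  have "f \<in> trunc_qmodule r [g, h] \<longleftrightarrow> (\<exists>\<sigma>. ?R (\<sigma> 0) (\<sigma> (1::nat)) (\<sigma> 2))"
    unfolding trunc_qmodule_def by (auto simp: le_Suc_eq all_conj_distrib numeral_2_eq_2)
  also have "\<dots> \<longleftrightarrow> (\<exists>s t u. ?R s t u)"
  proof
    assume "\<exists>s t u. ?R s t u"
    then obtain s t u where "?R s t u" by blast
    then show "\<exists>\<sigma>. ?R (\<sigma> 0) (\<sigma> (1::nat)) (\<sigma> 2)"
      by (intro exI[of _ "(!) [s, t, u]"]) simp
  qed blast
  finally show ?thesis .
qed

lemma degree_mult_transfer:
  fixes s :: "'a :: idom poly"
  assumes "degree (s * p) \<le> n" "p \<noteq> 0" "degree q \<le> degree p + k"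
  shows "degree (s * q) \<le> n + k"
proof (cases "s = 0")
  case False
  have "degree (s * q) \<le> degree s + degree q" by (rule degree_mult_le)
  also have "\<dots> \<le> degree s + degree p + k" using assms(3) by simp
  also have "degree s + degree p = degree (s * p)"
    using False assms(2) by (simp add: degree_mult_eq)
  finally show ?thesis using assms(1) by simp
qed simp

lemma trunc_qmodule_product_subset:
  "trunc_qmodule r [X ^ 3 * (1 - X)] \<subseteq> trunc_qmodule (Suc r) [X ^ 3, 1 - X]"
proof
  fix f assume "f \<in> trunc_qmodule r [X ^ 3 * (1 - X)]"
  then obtain s t where st: "f = s + t * (X ^ 3 * (1 - X))" "s \<in> sos" "t \<in> sos"
    "degree s \<le> 2 * r" "degree (t * (X ^ 3 * (1 - X))) \<le> 2 * r"
    unfolding mem_trunc_qmodule_1 by blast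
  have d: "degree (t * q) \<le> 2 * r + 1" if "degree q \<le> 5" for q
    using st(5) by (rule degree_mult_transfer) (use that in \<open>simp_all add: power3_eq_cube one_pCons\<close>)
  have eq: "f = s + (t * (1 - X)\<^sup>2) * X ^ 3 + (t * (X ^ 2)\<^sup>2) * (1 - X)"
    unfolding st(1) by (rule poly_ext) (simp add: algebra_simps eval_nat_numeral)
  have d1: "degree ((t * (1 - X)\<^sup>2) * X ^ 3) \<le> 2 * r + 1"
    unfolding mult.assoc by (rule d) (simp add: power3_eq_cube power2_eq_square one_pCons)
  have d2: "degree ((t * (X ^ 2)\<^sup>2) * (1 - X)) \<le> 2 * r + 1"
    unfolding mult.assoc by (rule d) (simp add: power3_eq_cube power2_eq_square one_pCons)
  show "f \<in> trunc_qmodule (Suc r) [X ^ 3, 1 - X]"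
    unfolding mem_trunc_qmodule_2
  proof (rule exI[of _ s], rule exI[of _ "t * (1 - X)\<^sup>2"], rule exI[of _ "t * (X ^ 2)\<^sup>2"],
      intro conjI eq st(2) sos_mult_square st(3))
  qed (use st(4) d1 d2 in simp_all)
qed

text \<open>Replacing \<open>u * (1 - X)\<close> raises the degree by three, yet the order increases only by one: a sum
  of squares has even degree, so the bound \<open>2 r\<close> on an odd degree leaves one unit to spare.\<close>

lemma trunc_qmodule_subset_product:
  "trunc_qmodule r [X ^ 3, 1 - X] \<subseteq> trunc_qmodule (Suc r) [X ^ 3 * (1 - X)]"
proof
  fix f assume "f \<in> trunc_qmodule r [X ^ 3, 1 - X]"
  then obtain s t u where stu: "f = s + t * X ^ 3 + u * (1 - X)" "s \<in> sos" "t \<in> sos" "u \<in> sos"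
    "degree s \<le> 2 * r" "degree (t * X ^ 3) \<le> 2 * r" "degree (u * (1 - X)) \<le> 2 * r"
    unfolding mem_trunc_qmodule_2 by blast
  \<comment> \<open>\<open>A\<^sup>2 + B\<^sup>2 = (1 - X)\<^sup>2 (1 + X + X\<^sup>2)\<close>, from \<open>1 + X + X\<^sup>2 = (1 + X / 2)\<^sup>2 + 3 / 4 X\<^sup>2\<close>.\<close>
  define A where "A = (1 - X) * [:1, 1 / 2:]"
  define B where "B = (1 - X) * [:0, sqrt 3 / 2:]"
  define s' where "s' = s + t * (X ^ 2)\<^sup>2 + (u * A\<^sup>2 + u * B\<^sup>2)"
  have eq: "f = s' + (t + u) * (X ^ 3 * (1 - X))"
    unfolding stu(1) s'_def A_def B_def
    by (rule poly_ext) (simp add: algebra_simps eval_nat_numeral)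
  have dt: "degree (t * q) \<le> 2 * r + 1" if "degree q \<le> 4" for q
    using stu(6) by (rule degree_mult_transfer) (use that in \<open>simp_all add: power3_eq_cube\<close>)
  have deg_u: "u = 0 \<or> degree u + 2 \<le> 2 * r"
  proof (cases "u = 0")
    case False
    have nz: "1 - X \<noteq> 0" and "degree (1 - X) = 1" by (simp_all add: one_pCons)
    with stu(7) have "degree u + 1 \<le> 2 * r"
      using degree_mult_eq[OF False nz] by simp
    moreover have "even (degree u)" by (rule even_degree_sos[OF stu(4)])
    ultimately have "degree u + 2 \<le> 2 * r" by presburger
    then show ?thesis ..
  qed simp
  then have du: "degree (u * q) \<le> 2 * Suc r" if "degree q \<le> 4" for q
    using degree_mult_le[of u q] that deg_u by fastforce
  have AB: "degree (A\<^sup>2) \<le> 4" "degree (B\<^sup>2) \<le> 4"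
    by (simp_all add: A_def B_def power2_eq_square one_pCons)
  have "degree s' \<le> 2 * Suc r"
    unfolding s'_def using stu(5) dt[of "(X ^ 2)\<^sup>2"] du AB
    by (intro degree_add_le) (auto simp: power2_eq_square)
  moreover have "degree ((t + u) * (X ^ 3 * (1 - X))) \<le> 2 * Suc r"
    unfolding distrib_right using dt[of "X ^ 3 * (1 - X)"] du[of "X ^ 3 * (1 - X)"]
    by (intro degree_add_le) (auto simp: power3_eq_cube one_pCons)
  moreover have "s' \<in> sos" "t + u \<in> sos"
    unfolding s'_def by (intro sos_add sos_mult_square stu)+
  ultimately show "f \<in> trunc_qmodule (Suc r) [X ^ 3 * (1 - X)]"
    unfolding mem_trunc_qmodule_1 using eq by blast
qed

section \<open>Relaxation errors\<close>

lemma optimal_certificate: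
  fixes m :: nat
  assumes "m \<ge> 1"
  shows "X - [:- (1 / (4 * real m * (real m + 1))):] \<in> trunc_qmodule (Suc m) [X ^ 3 * (1 - X)]"
proof -
  define \<epsilon> where "\<epsilon> = 1 / (4 * real m * (real m + 1))"
  let ?s = "(smult (sqrt \<epsilon>) (opt_cos m))\<^sup>2" and ?t = "(smult (sqrt \<epsilon>) (opt_sin m))\<^sup>2"
  have "\<epsilon> > 0" using assms by (simp add: \<epsilon>_def)
  have \<epsilon>_inv: "\<epsilon> * (1 + 4 * real m * (real m + 1) * x) = x + \<epsilon>" for x
    using assms by (simp add: \<epsilon>_def divide_simps)
  have eq: "X - [:- \<epsilon>:] = ?s + ?t * (X ^ 3 * (1 - X))"
  proof (rule poly_ext)
    fix x
    have "poly (?s + ?t * (X ^ 3 * (1 - X))) x =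
        \<epsilon> * ((poly (opt_cos m) x)\<^sup>2 + x ^ 3 * (1 - x) * (poly (opt_sin m) x)\<^sup>2)"
      using \<open>\<epsilon> > 0\<close> by (simp add: power_mult_distrib algebra_simps)
    then show "poly (X - [:- \<epsilon>:]) x = poly (?s + ?t * (X ^ 3 * (1 - X))) x"
      unfolding opt_norm \<epsilon>_inv by simp
  qed
  have deg_sq: "degree ((smult c p)\<^sup>2) \<le> 2 * k" if "degree p \<le> k" for c and p :: "real poly" and k
  proof -
    have "degree ((smult c p)\<^sup>2) \<le> degree (smult c p) * 2" by (rule degree_power_le)
    also have "\<dots> \<le> k * 2" using degree_smult_le[of c p] that by simp
    finally show ?thesis by simp
  qed
  have deg_s: "degree ?s \<le> 2 * Suc m"
    by (rule deg_sq[OF degree_opt_cos])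
  have "degree (?t * (X ^ 3 * (1 - X))) \<le> degree ?t + degree (X ^ 3 * (1 - X))"
    by (rule degree_mult_le)
  also have "\<dots> \<le> 2 * (m - 1) + 4"
    by (intro add_mono deg_sq degree_opt_sin assms) (simp add: power3_eq_cube one_pCons)
  also have "\<dots> = 2 * Suc m" using assms by simp
  finally have deg_t: "degree (?t * (X ^ 3 * (1 - X))) \<le> 2 * Suc m" .
  show ?thesis
    unfolding mem_trunc_qmodule_1 \<epsilon>_def[symmetric]
    by (intro exI[of _ ?s] exI[of _ ?t] conjI sos_square eq deg_s deg_t)
qed

text \<open>Applying the dual functional to a certificate of \<open>x - v\<close> gives
  \<open>0 \<le> L (x - v) = L (x + \<epsilon>) - (v + \<epsilon>) L 1 = - (v + \<epsilon>) L 1\<close>, and \<open>L 1 > 0\<close>.\<close>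

lemma admissible_bound_le:
  fixes m :: nat
  assumes "m \<ge> 1" "X - [:v:] \<in> trunc_qmodule (Suc m) [X ^ 3 * (1 - X)]"
  shows "v \<le> - (1 / (4 * real m * (real m + 1)))"
proof -
  define \<epsilon> where "\<epsilon> = 1 / (4 * real m * (real m + 1))"
  obtain s t where st: "X - [:v:] = s + t * (X ^ 3 * (1 - X))" "s \<in> sos" "t \<in> sos"
    "degree (t * (X ^ 3 * (1 - X))) \<le> 2 * Suc m"
    using assms(2) unfolding mem_trunc_qmodule_1 by blast
  obtain bs where bs: "t = (\<Sum>b\<leftarrow>bs. b\<^sup>2)"
    using st(3) unfolding sos_def by blast
  obtain d where d: "degree t = 2 * d" "\<And>b. b \<in> set bs \<Longrightarrow> degree b \<le> d"
    using degree_sum_squares[of bs] unfolding bs by blast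
  have "degree t \<le> 2 * (m - 1)"
  proof (cases "t = 0")
    case False
    have nz: "X ^ 3 * (1 - X) \<noteq> 0" and "degree (X ^ 3 * (1 - X)) = 4"
      by (simp_all add: power3_eq_cube one_pCons)
    with st(4) show ?thesis using degree_mult_eq[OF False nz] by simp
  qed simp
  then have deg_b: "degree b \<le> m - 1" if "b \<in> set bs" for b
    using d(1) d(2)[OF that] by simp
  obtain Y where Y: "finite Y" "Y \<noteq> {}" "0 \<notin> Y" "(\<Sum>y\<in>Y. (y + \<epsilon>) / y\<^sup>2) = 0"
    and psd: "\<And>b. degree b \<le> m - 1 \<Longrightarrow> (\<Sum>y\<in>Y. y ^ 3 * (1 - y) * (poly b y)\<^sup>2 / y\<^sup>2) \<ge> 0"
    using exists_dual_functional[OF assms(1)] unfolding \<epsilon>_def by blast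
  have psd_sum: "(\<Sum>y\<in>Y. y ^ 3 * (1 - y) * poly (\<Sum>b\<leftarrow>bs. b\<^sup>2) y / y\<^sup>2) \<ge> 0"
    if "\<forall>b\<in>set bs. degree b \<le> m - 1" for bs
    using that
  proof (induction bs)
    case (Cons b bs)
    have "(\<Sum>y\<in>Y. y ^ 3 * (1 - y) * poly (\<Sum>b\<leftarrow>b # bs. b\<^sup>2) y / y\<^sup>2) =
        (\<Sum>y\<in>Y. y ^ 3 * (1 - y) * (poly b y)\<^sup>2 / y\<^sup>2) +
        (\<Sum>y\<in>Y. y ^ 3 * (1 - y) * poly (\<Sum>b\<leftarrow>bs. b\<^sup>2) y / y\<^sup>2)"
      by (simp only: sum.distrib[symmetric] list.map sum_list.Cons poly_add poly_power
          distrib_left add_divide_distrib)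
    also have "\<dots> \<ge> 0"
      using Cons psd[of b] by (intro add_nonneg_nonneg) auto
    finally show ?case .
  qed simp
  have val: "y - v = poly s y + y ^ 3 * (1 - y) * poly t y" for y
  proof -
    have "y - v = poly (X - [:v:]) y" by simp
    also have "\<dots> = poly s y + y ^ 3 * (1 - y) * poly t y"
      unfolding st(1) by simp
    finally show ?thesis .
  qed
  have "0 \<le> (\<Sum>y\<in>Y. poly s y / y\<^sup>2)"
    by (intro sum_nonneg divide_nonneg_nonneg poly_sos_nonneg st) simp
  moreover have "0 \<le> (\<Sum>y\<in>Y. y ^ 3 * (1 - y) * poly t y / y\<^sup>2)"
    unfolding bs using deg_b by (intro psd_sum) blast
  ultimately have "0 \<le> (\<Sum>y\<in>Y. poly s y / y\<^sup>2) + (\<Sum>y\<in>Y. y ^ 3 * (1 - y) * poly t y / y\<^sup>2)"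
    by (rule add_nonneg_nonneg)
  also have "\<dots> = (\<Sum>y\<in>Y. (y - v) / y\<^sup>2)"
    by (simp only: sum.distrib[symmetric] add_divide_distrib val)
  also have "\<dots> = (\<Sum>y\<in>Y. (y + \<epsilon>) / y\<^sup>2 + (- \<epsilon> - v) * (1 / y\<^sup>2))"
    by (intro sum.cong refl) (simp add: add_divide_distrib[symmetric])
  also have "\<dots> = (- \<epsilon> - v) * (\<Sum>y\<in>Y. 1 / y\<^sup>2)"
    by (simp only: sum.distrib sum_distrib_left[symmetric] Y(4) add_0)
  finally have "0 \<le> (- \<epsilon> - v) * (\<Sum>y\<in>Y. 1 / y\<^sup>2)" .
  moreover have "(\<Sum>y\<in>Y. 1 / y\<^sup>2) > 0"
    using Y by (intro sum_pos) auto
  ultimately have "0 \<le> - \<epsilon> - v"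
    by (meson mult_neg_pos not_less)
  then show ?thesis by (simp add: \<epsilon>_def)
qed

lemma e1_value:
  fixes m :: nat
  assumes "m \<ge> 1"
  shows "e1 (Suc m) = ereal (1 / (4 * real m * (real m + 1)))"
proof -
  define \<epsilon> where "\<epsilon> = 1 / (4 * real m * (real m + 1))"
  have "(SUP v\<in>{v. X - [:v:] \<in> trunc_qmodule (Suc m) [X ^ 3 * (1 - X)]}. ereal v) = ereal (- \<epsilon>)"
  proof (rule antisym[OF SUP_least SUP_upper])
    show "ereal v \<le> ereal (- \<epsilon>)"
      if "v \<in> {v. X - [:v:] \<in> trunc_qmodule (Suc m) [X ^ 3 * (1 - X)]}" for v
      using admissible_bound_le[OF assms] that unfolding \<epsilon>_def ereal_less_eq mem_Collect_eq by blast
    show "- \<epsilon> \<in> {v. X - [:v:] \<in> trunc_qmodule (Suc m) [X ^ 3 * (1 - X)]}"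
      using optimal_certificate[OF assms] unfolding \<epsilon>_def mem_Collect_eq .
  qed
  then show ?thesis
    unfolding e1_eq \<epsilon>_def[symmetric] by (simp add: zero_ereal_def)
qed

lemma e1_Suc_le_e2: "e1 (Suc r) \<le> e2 r"
  unfolding e1_eq e2_eq using trunc_qmodule_subset_product[of r]
  by (intro ereal_minus_mono order.refl SUP_subset_mono) auto

lemma e2_Suc_le_e1: "e2 (Suc r) \<le> e1 r"
  unfolding e1_eq e2_eq using trunc_qmodule_product_subset[of r]
  by (intro ereal_minus_mono order.refl SUP_subset_mono) auto

lemma e1_pred_value:
  assumes "r \<ge> 3"
  shows "e1 (r - 1) = ereal (1 / (4 * (real r - 1) * (real r - 2)))"
proof -
  have "Suc (r - 2) = r - 1" "real (r - 2) = real r - 2" "1 \<le> r - 2"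
    using assms by auto
  then show ?thesis
    using e1_value[of "r - 2"] by (simp add: mult.assoc) (simp add: algebra_simps)
qed

lemma tendsto_scaled_error:
  "(\<lambda>r. (real r)\<^sup>2 * (1 / (4 * (real r + a) * (real r + b)))) \<longlonglongrightarrow> 1 / 4"
  by real_asymp

lemma tendsto_e1: "(\<lambda>r. ereal ((real r)\<^sup>2) * e1 r) \<longlonglongrightarrow> ereal (1 / 4)"
proof (rule Lim_transform_eventually)
  show "(\<lambda>r. ereal ((real r)\<^sup>2 * (1 / (4 * (real r + (- 1)) * (real r + 0))))) \<longlonglongrightarrow> ereal (1 / 4)"
    by (intro tendsto_ereal tendsto_scaled_error)
  show "\<forall>\<^sub>F r in sequentially.
      ereal ((real r)\<^sup>2 * (1 / (4 * (real r + (- 1)) * (real r + 0)))) = ereal ((real r)\<^sup>2) * e1 r"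
    using eventually_ge_at_top[of 2]
  proof eventually_elim
    case (elim r)
    then show ?case using e1_value[of "r - 1"] by (simp add: of_nat_diff)
  qed
qed

theorem corollary1:
  "(\<forall>r::nat. r \<ge> 3 \<longrightarrow>
      ereal (1 / (4 * real r * (real r + 1))) = e1 (r + 1) \<and>
      e1 (r + 1) \<le> e2 r \<and>
      e2 r \<le> e1 (r - 1) \<and>
      e1 (r - 1) = ereal (1 / (4 * (real r - 1) * (real r - 2)))) \<and>
   (\<lambda>r::nat. ereal ((real r)\<^sup>2) * e2 r) \<longlonglongrightarrow> ereal (1 / 4) \<and>
   (\<lambda>r::nat. ereal ((real r)\<^sup>2) * e1 r) \<longlonglongrightarrow> ereal (1 / 4)"
proof (intro conjI allI impI)
  fix r :: nat assume r: "r \<ge> 3"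
  show "ereal (1 / (4 * real r * (real r + 1))) = e1 (r + 1)"
    using e1_value[of r] r by simp
  show "e1 (r + 1) \<le> e2 r"
    using e1_Suc_le_e2[of r] by simp
  show "e2 r \<le> e1 (r - 1)"
    using e2_Suc_le_e1[of "r - 1"] r by simp
  show "e1 (r - 1) = ereal (1 / (4 * (real r - 1) * (real r - 2)))"
    by (rule e1_pred_value[OF r])
next
  show "(\<lambda>r. ereal ((real r)\<^sup>2) * e2 r) \<longlonglongrightarrow> ereal (1 / 4)"
  proof (rule tendsto_sandwich)
    show "(\<lambda>r. ereal ((real r)\<^sup>2 * (1 / (4 * (real r + 0) * (real r + 1))))) \<longlonglongrightarrow> ereal (1 / 4)"
      "(\<lambda>r. ereal ((real r)\<^sup>2 * (1 / (4 * (real r + (- 1)) * (real r + (- 2)))))) \<longlonglongrightarrow> ereal (1 / 4)"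
      by (intro tendsto_ereal tendsto_scaled_error)+
    show "\<forall>\<^sub>F r in sequentially.
        ereal ((real r)\<^sup>2 * (1 / (4 * (real r + 0) * (real r + 1)))) \<le> ereal ((real r)\<^sup>2) * e2 r"
      using eventually_ge_at_top[of 3]
    proof eventually_elim
      case (elim r)
      then have "ereal (1 / (4 * (real r + 0) * (real r + 1))) \<le> e2 r"
        using e1_value[of r] e1_Suc_le_e2[of r] by simp
      from ereal_mult_left_mono[OF this, of "ereal ((real r)\<^sup>2)"] show ?case by simp
    qed
    show "\<forall>\<^sub>F r in sequentially.
        ereal ((real r)\<^sup>2) * e2 r \<le> ereal ((real r)\<^sup>2 * (1 / (4 * (real r + (- 1)) * (real r + (- 2)))))"
      using eventually_ge_at_top[of 3]
    proof eventually_elim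
      case (elim r)
      then have "e2 r \<le> ereal (1 / (4 * (real r + (- 1)) * (real r + (- 2))))"
        using e1_pred_value[of r] e2_Suc_le_e1[of "r - 1"] by simp
      from ereal_mult_left_mono[OF this, of "ereal ((real r)\<^sup>2)"] show ?case by simp
    qed
  qed
qed (rule tendsto_e1)

end
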